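(* There is a solution to the $5$ gods puzzle with $2$ random and $3$ truthful gods (and no lying gods) that uses $4.15$ questions on average.
   Context: The puzzle: there are $5$ distinguishable gods $\gamma_1,\dots,\gamma_5$. Exactly $2$ of them are random ($\mathcal{R}$) and exactly $3$ are truthful ($\mathcal{T}$). The solver knows these numbers but not which god has which type, so there are $\binom{5}{2}=10$ possible assignments. The solver asks yes/no questions one at a time, each directed at one god of the solver's choice, and questions may be chosen adaptively. The gods understand the questions but answer with one of two words, one of which is `$\chi$'. One of the two words means yes and the other means no, and the solver does not know which (and need not find out). A question is any yes/no question having a definite truth value given the actual state (the types of the gods and the meaning of $\chi$), including hypothetical questions to a non-random god about how that god would answer some other question. A truthful god gives the word for the true answer. A random god answers each question with one of the two words, each with probability $1/2$, independently. A solution is an adaptive strategy that, whatever the assignment of types, the meaning of $\chi$ and the answers of the random gods, stops after finitely many questions with the type of every god determined with certainty. The average number of questions of a solution is the arithmetic mean, over the $10$ possible assignments of types, of the expected number of questions asked under that assignment (the expectation being over the random gods' answers). *)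

theory Defs
  imports "HOL-Probability.Probability_Mass_Function"
begin

datatype god = \<gamma>1 | \<gamma>2 | \<gamma>3 | \<gamma>4 | \<gamma>5

datatype god_type = Random | Truthful

type_synonym assignment = "god \<Rightarrow> god_type"

datatype answer_word = Chi | Other

definition assignments :: "assignment set" where
  "assignments = {a. card {g. a g = Random} = 2 \<and> card {g. a g = Truthful} = 3}"

text \<open>The actual state: the types of the gods, and which of the two words means yes.\<close>

datatype state = State (types: assignment) (yes_word: answer_word)

definition possible_states :: "state set" where
  "possible_states = {s. types s \<in> assignments}"

text \<open>A question is identified with its truth value in each state. This covers hypothetical
  questions: ``would you answer \<open>Chi\<close> to \<open>q\<close>?'' is \<open>\<lambda>s. truthful_answer s q = Chi\<close>; its value
  when the addressee is random is immaterial, since a random god ignores the question.\<close>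

type_synonym question = "state \<Rightarrow> bool"

definition no_word :: "state \<Rightarrow> answer_word" where
  "no_word s = (case yes_word s of Chi \<Rightarrow> Other | Other \<Rightarrow> Chi)"

definition truthful_answer :: "state \<Rightarrow> question \<Rightarrow> answer_word" where
  "truthful_answer s q = (if q s then yes_word s else no_word s)"

definition answer :: "state \<Rightarrow> god \<Rightarrow> question \<Rightarrow> answer_word pmf" where
  "answer s g q =
     (case types s g of
        Truthful \<Rightarrow> return_pmf (truthful_answer s q)
      | Random \<Rightarrow> pmf_of_set {Chi, Other})"

text \<open>An adaptive strategy is a decision tree: either stop and announce the types, or put a
  question to a god and continue with the first subtree on the answer \<open>Chi\<close> and with the
  second one on the answer \<open>Other\<close>. Every branch of such a tree is finite, so stopping after
  finitely many questions is part of the type.\<close>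

datatype strategy =
    Stop assignment
  | Ask god question strategy strategy

text \<open>The joint distribution of the number of questions asked and the announced types. The
  answers of random gods are independent, since each one is drawn afresh.\<close>

primrec run :: "strategy \<Rightarrow> state \<Rightarrow> (nat \<times> assignment) pmf" where
  "run (Stop a) s = return_pmf (0, a)"
| "run (Ask g q t u) s =
     bind_pmf (answer s g q)
       (\<lambda>w. map_pmf (apfst Suc) (case w of Chi \<Rightarrow> run t s | Other \<Rightarrow> run u s))"

text \<open>Both words have positive probability as answers of a random god, so the support of
  \<open>run t s\<close> accounts for all their possible answers.\<close>

definition solution :: "strategy \<Rightarrow> bool" where
  "solution t \<longleftrightarrow> (\<forall>s \<in> possible_states. \<forall>(n, a) \<in> set_pmf (run t s). a = types s)"

definition expected_questions :: "strategy \<Rightarrow> state \<Rightarrow> real" where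
  "expected_questions t s = measure_pmf.expectation (run t s) (\<lambda>(n, a). real n)"

text \<open>The mean is over the type assignments only; the word meaning yes is a parameter \<open>y\<close>.\<close>

definition average_questions :: "strategy \<Rightarrow> answer_word \<Rightarrow> real" where
  "average_questions t y =
     (\<Sum>a\<in>assignments. expected_questions t (State a y)) / real (card assignments)"

end

theory Submission
  imports Defs
begin

text \<open>
  A truthful god can be made to reveal whether the assignment of types has a given property \<open>P\<close>,
  although the meaning of the words is unknown: the question ``is \<open>P\<close> true if and only if \<open>Chi\<close>
  means yes?'' is answered by \<open>Chi\<close> exactly when \<open>P\<close> holds (\<open>truthful_answer_chi_iff\<close>). With such
  questions the puzzle is a search among ten pairs of random gods. A question put to \<open>g\<close> sends
  each pair without \<open>g\<close> to the branch that its truth value selects, and each pair containing \<open>g\<close>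
  to both branches, with half its weight on either side, where the weight of a pair at a node is
  the probability that the node is reached when that pair is the random one.

  A tree of such questions is a solution as soon as a single pair is left at each leaf, and the
  sum over the ten assignments of the expected number of questions is the sum, over the asking
  nodes, of the weights of all pairs present there. The tree \<open>strategy_5\<close> below asks \<open>\<gamma>1\<close> whether
  \<open>\<gamma>2\<close> is random. The root has weight 10, the subtree after the answer \<open>Chi\<close> has
  weight 65/4, and the one after the other answer has weight 61/4. The total is 83/2, hence
  the average is 83/20 = 4.15, whichever word means yes.

  The bookkeeping is done by two recursions along the tree, one for the possible announcements
  (\<open>announced_Ask\<close>) and one for the expected number of questions (\<open>expected_questions_Ask\<close>), which
  are then evaluated at each of the ten assignments (\<open>assignments_eq\<close>).
\<close>

section \<open>Questions whose answer can be read without knowing the language\<close>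

definition chi_iff :: "(assignment \<Rightarrow> bool) \<Rightarrow> question" where
  "chi_iff P = (\<lambda>s. P (types s) \<longleftrightarrow> yes_word s = Chi)"

lemma truthful_answer_chi_iff:
  "truthful_answer s (chi_iff P) = (if P (types s) then Chi else Other)"
  by (cases "yes_word s") (auto simp: truthful_answer_def no_word_def chi_iff_def)

section \<open>Recursion along the decision tree\<close>

lemma run_Ask_Truthful:
  assumes "types s g = Truthful"
  shows "run (Ask g (chi_iff P) t u) s = map_pmf (apfst Suc) (run (if P (types s) then t else u) s)"
  using assms by (simp add: answer_def truthful_answer_chi_iff bind_return_pmf)

lemma run_Ask_Random:
  assumes "types s g = Random"
  shows "run (Ask g q t u) s =
    pmf_of_set {Chi, Other} \<bind> (\<lambda>w. map_pmf (apfst Suc) (case w of Chi \<Rightarrow> run t s | Other \<Rightarrow> run u s))"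
  using assms by (simp add: answer_def)

text \<open>Finite support makes every function integrable, so that expectations can be split freely.\<close>

lemma finite_set_pmf_run: "finite (set_pmf (run t s))"
proof (induction t)
  case (Ask g q t u)
  have "finite (set_pmf (answer s g q))"
    by (rule finite_subset[of _ "{Chi, Other}"]) (use answer_word.exhaust in auto)
  then show ?case
    using Ask by (auto split: answer_word.split)
qed simp

lemma expectation_Suc_run:
  "measure_pmf.expectation (map_pmf (apfst Suc) (run t s)) (\<lambda>(n, a). real n)
     = 1 + expected_questions t s"
proof -
  have "measure_pmf.expectation (map_pmf (apfst Suc) (run t s)) (\<lambda>(n, a). real n)
      = measure_pmf.expectation (run t s) (\<lambda>x. 1 + (case x of (n, a) \<Rightarrow> real n))"
    by (simp add: case_prod_beta)
  also have "\<dots> = 1 + expected_questions t s"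
    unfolding expected_questions_def
    by (subst Bochner_Integration.integral_add)
      (auto intro: integrable_measure_pmf_finite finite_set_pmf_run)
  finally show ?thesis .
qed

lemma expected_questions_Stop: "expected_questions (Stop a) s = 0"
  by (simp add: expected_questions_def)

lemma expected_questions_Ask:
  "expected_questions (Ask g (chi_iff P) t u) s = 1 +
     (if types s g = Random then (expected_questions t s + expected_questions u s) / 2
      else if P (types s) then expected_questions t s else expected_questions u s)"
proof (cases "types s g")
  case Random
  have "expected_questions (Ask g (chi_iff P) t u) s =
    (\<Sum>w\<in>{Chi, Other}. measure_pmf.expectation
       (map_pmf (apfst Suc) (case w of Chi \<Rightarrow> run t s | Other \<Rightarrow> run u s)) (\<lambda>(n, a). real n) / 2)"
    unfolding expected_questions_def run_Ask_Random[of s g, OF Random]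
    by (subst pmf_expectation_bind_pmf_of_set)
      (auto simp: finite_set_pmf_run field_simps split: answer_word.split)
  also have "\<dots> = 1 + (expected_questions t s + expected_questions u s) / 2"
    by (simp add: expectation_Suc_run field_simps del: integral_map_pmf)
  finally show ?thesis using Random by simp
next
  case Truthful
  then show ?thesis
    using expectation_Suc_run
    by (simp add: expected_questions_def run_Ask_Truthful del: integral_map_pmf run.simps)
qed

text \<open>Being a solution only concerns the support of the announcements, where the number of
  questions and the probabilities can be forgotten; this leaves a recursion on sets.\<close>

definition announced :: "strategy \<Rightarrow> state \<Rightarrow> assignment set" where
  "announced t s = snd ` set_pmf (run t s)"

lemma solution_iff_announced:
  "solution t \<longleftrightarrow> (\<forall>s\<in>possible_states. announced t s \<subseteq> {types s})"
  by (fastforce simp: solution_def announced_def)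

lemma announced_Stop: "announced (Stop a) s = {a}"
  by (simp add: announced_def)

lemma announced_Ask:
  "announced (Ask g (chi_iff P) t u) s =
     (if types s g = Random then announced t s \<union> announced u s
      else if P (types s) then announced t s else announced u s)"
  by (cases "types s g")
    (auto simp: announced_def run_Ask_Random run_Ask_Truthful image_image image_Un
      simp del: run.simps)

section \<open>The ten assignments\<close>

definition randoms :: "god \<Rightarrow> god \<Rightarrow> assignment" where
  "randoms g h = (\<lambda>x. if x = g \<or> x = h then Random else Truthful)"

lemma randoms_eq_iff: "randoms g h = randoms g' h' \<longleftrightarrow> {g, h} = {g', h'}"
proof -
  have "{x. randoms k l x = Random} = {k, l}" for k l
    by (auto simp: randoms_def)
  moreover have "randoms g h = randoms g' h'" if "{g, h} = {g', h'}"
    using that by (auto simp: randoms_def fun_eq_iff doubleton_eq_iff)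
  ultimately show ?thesis by metis
qed

lemma UNIV_god: "(UNIV :: god set) = {\<gamma>1, \<gamma>2, \<gamma>3, \<gamma>4, \<gamma>5}"
  using god.exhaust by auto

lemma randoms_in_assignments:
  assumes "g \<noteq> h"
  shows "randoms g h \<in> assignments"
proof -
  have "{x. randoms g h x = Random} = {g, h}" "{x. randoms g h x = Truthful} = UNIV - {g, h}"
    by (auto simp: randoms_def)
  moreover have "card (UNIV - {g, h}) = 3"
  proof -
    have "card (UNIV :: god set) = 5"
      by (simp add: UNIV_god)
    then show ?thesis
      using assms by (simp add: card_Diff_subset)
  qed
  ultimately show ?thesis
    using assms by (simp add: assignments_def)
qed

lemma assignments_eq:
  "assignments =
    {randoms \<gamma>1 \<gamma>2, randoms \<gamma>1 \<gamma>3, randoms \<gamma>1 \<gamma>4, randoms \<gamma>1 \<gamma>5, randoms \<gamma>2 \<gamma>3,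
     randoms \<gamma>2 \<gamma>4, randoms \<gamma>2 \<gamma>5, randoms \<gamma>3 \<gamma>4, randoms \<gamma>3 \<gamma>5, randoms \<gamma>4 \<gamma>5}"
  (is "_ = ?R")
proof
  show "?R \<subseteq> assignments"
    by (simp add: randoms_in_assignments)
  show "assignments \<subseteq> ?R"
  proof
    fix a assume "a \<in> assignments"
    then obtain g h where gh: "g \<noteq> h" "{x. a x = Random} = {g, h}"
      by (auto simp: assignments_def card_2_iff)
    have "a x = randoms g h x" for x
    proof -
      have "a x = Random \<longleftrightarrow> x \<in> {g, h}"
        using gh(2) by blast
      then show ?thesis
        by (cases "a x") (auto simp: randoms_def)
    qed
    then have "a = randoms g h" by blast
    with gh(1) show "a \<in> ?R"
      by (cases g; cases h) (simp_all add: randoms_eq_iff doubleton_eq_iff)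
  qed
qed

section \<open>The strategy\<close>

abbreviation random :: "god \<Rightarrow> assignment \<Rightarrow> bool" where
  "random g a \<equiv> a g = Random"

text \<open>
  A pair is written by its two indices, followed by its weight in parentheses. After \<open>Chi\<close> to the
  first question, the pairs are 12, 13, 14, 15 (1/2 each) and 23, 24, 25 (1 each), of total
  weight 5. The next question, to \<open>\<gamma>3\<close>, separates 24 from 12, 14, 15, 25.

  \<^item> After \<open>Chi\<close>: 13 (1/4), 23 (1/2), 24 (1) are left. The god \<open>\<gamma>5\<close> is certainly truthful and splits
    off the heaviest pair 24; then \<open>\<gamma>4\<close> is truthful as well. Weight 7/4 + 3/4.

  \<^item> After \<open>Other\<close>: 12, 14, 15, 23 (1/2 each), 13 (1/4), 25 (1) are left, of weight 13/4. Now \<open>\<gamma>4\<close> is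
    asked about \<open>\<gamma>5\<close>; only 14 goes both ways, so that one side has 14 (1/4), 15 (1/2), 25 (1), and
    the other one has 12 (1/2), 13 (1/4), 14 (1/4), 23 (1/2). From here on only certainly truthful
    gods are asked, and a heaviest pair is split off each time.
    Weight 7/4 + 3/4 on the first side and 3/2 + 1 + 1/2 on the second.

  Altogether this is 5 + 5/2 + 13/4 + 5/2 + 3 = 65/4.
\<close>

definition branch2 :: strategy where
  "branch2 =
    Ask \<gamma>3 (chi_iff (\<lambda>a. random \<gamma>2 a \<and> random \<gamma>4 a))
      (Ask \<gamma>5 (chi_iff (random \<gamma>3))
        (Ask \<gamma>4 (chi_iff (random \<gamma>1)) (Stop (randoms \<gamma>1 \<gamma>3)) (Stop (randoms \<gamma>2 \<gamma>3)))
        (Stop (randoms \<gamma>2 \<gamma>4)))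
      (Ask \<gamma>4 (chi_iff (random \<gamma>5))
        (Ask \<gamma>3 (chi_iff (random \<gamma>1))
          (Ask \<gamma>2 (chi_iff (random \<gamma>4)) (Stop (randoms \<gamma>1 \<gamma>4)) (Stop (randoms \<gamma>1 \<gamma>5)))
          (Stop (randoms \<gamma>2 \<gamma>5)))
        (Ask \<gamma>5 (chi_iff (\<lambda>a. random \<gamma>1 a \<and> random \<gamma>2 a))
          (Stop (randoms \<gamma>1 \<gamma>2))
          (Ask \<gamma>5 (chi_iff (random \<gamma>1))
            (Ask \<gamma>2 (chi_iff (random \<gamma>3)) (Stop (randoms \<gamma>1 \<gamma>3)) (Stop (randoms \<gamma>1 \<gamma>4)))
            (Stop (randoms \<gamma>2 \<gamma>3)))))"

text \<open>
  Here the pairs are 12, 13, 14, 15 (1/2 each) and 34, 35, 45 (1 each), again of total weight 5.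
  The next question, to \<open>\<gamma>2\<close>, separates 13, 34 from 14, 15, 35, 45, and only 12 goes both ways.

  \<^item> After \<open>Chi\<close>: 12 (1/4), 13 (1/2), 34 (1) are left. The god \<open>\<gamma>5\<close> is truthful and splits off 34;
    then \<open>\<gamma>4\<close> is truthful as well. Weight 7/4 + 3/4.

  \<^item> After \<open>Other\<close>: 12 (1/4), 14, 15 (1/2 each), 35, 45 (1 each) are left, of weight 13/4. It pays
    to ask \<open>\<gamma>2\<close> again: being random would mean the light pair 12, and the other four pairs are
    cut into halves of equal weight. Either half has three pairs,
    of weights 1/8, 1/2 and 1, and a god who is truthful in all of them. Weight 13/8 + 5/8 each.

  Altogether this is 5 + 5/2 + 13/4 + 9/4 + 9/4 = 61/4.
\<close>

definition branch345 :: strategy where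
  "branch345 =
    Ask \<gamma>2 (chi_iff (\<lambda>a. random \<gamma>3 a \<and> \<not> random \<gamma>5 a))
      (Ask \<gamma>5 (chi_iff (random \<gamma>1))
        (Ask \<gamma>4 (chi_iff (random \<gamma>2)) (Stop (randoms \<gamma>1 \<gamma>2)) (Stop (randoms \<gamma>1 \<gamma>3)))
        (Stop (randoms \<gamma>3 \<gamma>4)))
      (Ask \<gamma>2 (chi_iff (random \<gamma>4))
        (Ask \<gamma>3 (chi_iff (random \<gamma>1))
          (Ask \<gamma>3 (chi_iff (random \<gamma>2)) (Stop (randoms \<gamma>1 \<gamma>2)) (Stop (randoms \<gamma>1 \<gamma>4)))
          (Stop (randoms \<gamma>4 \<gamma>5)))
        (Ask \<gamma>4 (chi_iff (random \<gamma>1))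
          (Ask \<gamma>4 (chi_iff (random \<gamma>2)) (Stop (randoms \<gamma>1 \<gamma>2)) (Stop (randoms \<gamma>1 \<gamma>5)))
          (Stop (randoms \<gamma>3 \<gamma>5))))"

definition strategy_5 :: strategy where
  "strategy_5 = Ask \<gamma>1 (chi_iff (random \<gamma>2)) branch2 branch345"

lemmas strategy_defs = strategy_5_def branch2_def branch345_def

lemma solution_strategy_5: "solution strategy_5"
proof -
  have "announced strategy_5 (State a y) \<subseteq> {a}" if "a \<in> assignments" for a y
    using that unfolding assignments_eq
    by (elim insertE emptyE; hypsubst)
      (simp_all add: strategy_defs announced_Ask announced_Stop randoms_def)
  then show ?thesis
    by (auto simp: solution_iff_announced possible_states_def) (metis state.exhaust_sel singletonD subsetD)
qed

lemma average_questions_strategy_5: "average_questions strategy_5 y = 4.15"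
proof -
  let ?E = "\<lambda>g h. expected_questions strategy_5 (State (randoms g h) y)"
  have "(\<Sum>a\<in>assignments. expected_questions strategy_5 (State a y)) =
    ?E \<gamma>1 \<gamma>2 + ?E \<gamma>1 \<gamma>3 + ?E \<gamma>1 \<gamma>4 + ?E \<gamma>1 \<gamma>5 + ?E \<gamma>2 \<gamma>3 +
    ?E \<gamma>2 \<gamma>4 + ?E \<gamma>2 \<gamma>5 + ?E \<gamma>3 \<gamma>4 + ?E \<gamma>3 \<gamma>5 + ?E \<gamma>4 \<gamma>5"
    by (simp add: assignments_eq randoms_eq_iff doubleton_eq_iff)
  also have "\<dots> = 83 / 2"
    by (simp add: strategy_defs expected_questions_Ask expected_questions_Stop randoms_def)
  finally show ?thesis
    by (simp add: average_questions_def assignments_eq randoms_eq_iff doubleton_eq_iff)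
qed

theorem mainTheorem3:
  "\<exists>t. solution t \<and> (\<forall>y. average_questions t y = 4.15)"
  using solution_strategy_5 average_questions_strategy_5 by blast

end
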